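(* For any modal formula $A$, the following are equivalent: (1) $\mathbf{N4}\vdash A$; (2) $A$ is valid in all transitive $\mathbf{N}$-frames; (3) $A$ is valid in all finite transitive $\mathbf{N}$-frames; (4) $A$ is valid in all finite $\mathrm{Sub}(A)$-transitive $\mathbf{N}$-frames.
   Context: Modal formulas are built from propositional variables and $\bot$ using $\neg,\land,\lor,\to$ and $\Box$; $\mathrm{Sub}(A)$ is the set of subformulas of $A$. $\mathbf{N}$ has all propositional tautologies as axioms and Modus Ponens and Necessitation $A/\Box A$ as rules; $\mathbf{N4}$ is $\mathbf{N}$ plus the axiom scheme $\Box B\to\Box\Box B$. An $\mathbf{N}$-frame is $(W, \{\prec_B\}_B)$ with $W$ nonempty and a binary relation $\prec_B$ on $W$ for each modal formula $B$ (finite if $W$ is finite); an $\mathbf{N}$-model adds $\Vdash$ with usual propositional clauses and $x\Vdash\Box B$ iff $y\Vdash B$ for all $y$ with $x\prec_B y$. Validity in a frame means truth at all worlds of all models on the frame. The frame is $B$-transitive if for all $x,y,z$, $x\prec_{\Box B} y$ and $y\prec_B z$ imply $x\prec_B z$; it is $\Gamma$-transitive if it is $B$-transitive for every $B$ with $\Box\Box B\in\Gamma$; it is transitive if $B$-transitive for all $B$. *)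

theory Defs
  imports Main
begin

datatype 'p fm =
    Var 'p
  | Bot
  | Neg "'p fm"
  | Conj "'p fm" "'p fm"
  | Disj "'p fm" "'p fm"
  | Imp "'p fm" "'p fm"
  | Box "'p fm"

primrec Sub :: "'p fm \<Rightarrow> 'p fm set" where
  "Sub (Var p) = {Var p}"
| "Sub Bot = {Bot}"
| "Sub (Neg A) = insert (Neg A) (Sub A)"
| "Sub (Conj A B) = insert (Conj A B) (Sub A \<union> Sub B)"
| "Sub (Disj A B) = insert (Disj A B) (Sub A \<union> Sub B)"
| "Sub (Imp A B) = insert (Imp A B) (Sub A \<union> Sub B)"
| "Sub (Box A) = insert (Box A) (Sub A)"

text \<open>Propositional evaluation: boxed formulas are treated as atoms, so that the tautologies
  below are exactly the modal substitution instances of classical tautologies.\<close>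

primrec prop_eval :: "('p fm \<Rightarrow> bool) \<Rightarrow> 'p fm \<Rightarrow> bool" where
  "prop_eval v (Var p) = v (Var p)"
| "prop_eval v Bot = False"
| "prop_eval v (Neg A) = (\<not> prop_eval v A)"
| "prop_eval v (Conj A B) = (prop_eval v A \<and> prop_eval v B)"
| "prop_eval v (Disj A B) = (prop_eval v A \<or> prop_eval v B)"
| "prop_eval v (Imp A B) = (prop_eval v A \<longrightarrow> prop_eval v B)"
| "prop_eval v (Box A) = v (Box A)"

definition tautology :: "'p fm \<Rightarrow> bool" where
  "tautology A \<longleftrightarrow> (\<forall>v. prop_eval v A)"

text \<open>\<open>N_plus Ax\<close> is provability in the logic \<open>\<^bold>N\<close> extended by the axioms in \<open>Ax\<close>;
  \<open>\<^bold>N\<close> itself is \<open>N_plus {}\<close>. No closure under substitution is built in, so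
  axiom schemes are given as the set of all their instances.\<close>

inductive N_plus :: "'p fm set \<Rightarrow> 'p fm \<Rightarrow> bool" for Ax :: "'p fm set" where
  Taut: "tautology A \<Longrightarrow> N_plus Ax A"
| Axiom: "A \<in> Ax \<Longrightarrow> N_plus Ax A"
| MP: "N_plus Ax (Imp A B) \<Longrightarrow> N_plus Ax A \<Longrightarrow> N_plus Ax B"
| Nec: "N_plus Ax A \<Longrightarrow> N_plus Ax (Box A)"

definition N4 :: "'p fm \<Rightarrow> bool" where
  "N4 = N_plus {Imp (Box B) (Box (Box B)) | B. True}"

text \<open>A frame consists of a carrier \<open>W\<close> and a family \<open>R\<close> of relations on it, where
  \<open>(x, y) \<in> R B\<close> stands for \<open>x \<prec>\<^sub>B y\<close>.\<close>

definition N_frame :: "'w set \<Rightarrow> ('p fm \<Rightarrow> ('w \<times> 'w) set) \<Rightarrow> bool" where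
  "N_frame W R \<longleftrightarrow> W \<noteq> {} \<and> (\<forall>B. R B \<subseteq> W \<times> W)"

definition N_model ::
    "'w set \<Rightarrow> ('p fm \<Rightarrow> ('w \<times> 'w) set) \<Rightarrow> ('w \<Rightarrow> 'p fm \<Rightarrow> bool) \<Rightarrow> bool" where
  "N_model W R sat \<longleftrightarrow> N_frame W R \<and>
    (\<forall>x\<in>W.
      \<not> sat x Bot \<and>
      (\<forall>B. sat x (Neg B) \<longleftrightarrow> \<not> sat x B) \<and>
      (\<forall>B C. sat x (Conj B C) \<longleftrightarrow> sat x B \<and> sat x C) \<and>
      (\<forall>B C. sat x (Disj B C) \<longleftrightarrow> sat x B \<or> sat x C) \<and>
      (\<forall>B C. sat x (Imp B C) \<longleftrightarrow> (sat x B \<longrightarrow> sat x C)) \<and>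
      (\<forall>B. sat x (Box B) \<longleftrightarrow> (\<forall>y\<in>W. (x, y) \<in> R B \<longrightarrow> sat y B)))"

definition valid_in :: "'w set \<Rightarrow> ('p fm \<Rightarrow> ('w \<times> 'w) set) \<Rightarrow> 'p fm \<Rightarrow> bool" where
  "valid_in W R A \<longleftrightarrow> (\<forall>sat. N_model W R sat \<longrightarrow> (\<forall>x\<in>W. sat x A))"

definition fm_transitive :: "'p fm \<Rightarrow> 'w set \<Rightarrow> ('p fm \<Rightarrow> ('w \<times> 'w) set) \<Rightarrow> bool" where
  "fm_transitive B W R \<longleftrightarrow>
    (\<forall>x\<in>W. \<forall>y\<in>W. \<forall>z\<in>W. (x, y) \<in> R (Box B) \<longrightarrow> (y, z) \<in> R B \<longrightarrow> (x, z) \<in> R B)"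

definition set_transitive :: "'p fm set \<Rightarrow> 'w set \<Rightarrow> ('p fm \<Rightarrow> ('w \<times> 'w) set) \<Rightarrow> bool" where
  "set_transitive \<Gamma> W R \<longleftrightarrow> (\<forall>B. Box (Box B) \<in> \<Gamma> \<longrightarrow> fm_transitive B W R)"

definition transitive_frame :: "'w set \<Rightarrow> ('p fm \<Rightarrow> ('w \<times> 'w) set) \<Rightarrow> bool" where
  "transitive_frame W R \<longleftrightarrow> (\<forall>B. fm_transitive B W R)"

text \<open>HOL cannot quantify over all types inside a formula, so "all frames" is read as all frames
  whose carrier is a nonempty subset of an arbitrary type \<open>'w\<close>, passed as a type argument.\<close>

definition valid_transitive :: "'w itself \<Rightarrow> 'p fm \<Rightarrow> bool" where
  "valid_transitive _ A \<longleftrightarrow>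
    (\<forall>(W :: 'w set) R. N_frame W R \<and> transitive_frame W R \<longrightarrow> valid_in W R A)"

definition valid_finite_transitive :: "'w itself \<Rightarrow> 'p fm \<Rightarrow> bool" where
  "valid_finite_transitive _ A \<longleftrightarrow>
    (\<forall>(W :: 'w set) R. N_frame W R \<and> finite W \<and> transitive_frame W R \<longrightarrow> valid_in W R A)"

definition valid_finite_Sub_transitive :: "'w itself \<Rightarrow> 'p fm \<Rightarrow> bool" where
  "valid_finite_Sub_transitive _ A \<longleftrightarrow>
    (\<forall>(W :: 'w set) R. N_frame W R \<and> finite W \<and> set_transitive (Sub A) W R \<longrightarrow> valid_in W R A)"

end

theory Submission
  imports Defs
begin

text \<open>Completeness rests on worlds that are traces \<open>{D \<in> Sub A. prop_eval v D}\<close> of propositional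
  valuations, such that every theorem is true under some valuation with that trace; put
  \<open>X \<prec>\<^sub>B Y\<close> iff \<open>\<box>B \<in> X\<close> implies \<open>B \<in> Y\<close>. As only finitely many traces exist, every unprovable
  subformula of \<open>A\<close> is missing from some world, and this together with necessitation yields the
  truth lemma. The resulting frame is only \<open>Sub(A)\<close>-transitive. However, if one
  empties \<open>\<prec>\<^sub>B\<close> for every \<open>B\<close> with \<open>\<box>B \<notin> Sub(A)\<close>, a \<open>Sub(A)\<close>-transitive frame becomes transitive
  while the truth of \<open>A\<close> is unaffected.\<close>

section \<open>Subformula closure\<close>

lemma Sub_refl: "A \<in> Sub A"
  by (cases A) auto

lemma Sub_mono: "B \<in> Sub A \<Longrightarrow> Sub B \<subseteq> Sub A"
  by (induction A) auto

lemma finite_Sub: "finite (Sub A)"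
  by (induction A) auto

lemma Sub_closed:
  "Neg B \<in> Sub A \<Longrightarrow> B \<in> Sub A"
  "Conj B C \<in> Sub A \<Longrightarrow> B \<in> Sub A \<and> C \<in> Sub A"
  "Disj B C \<in> Sub A \<Longrightarrow> B \<in> Sub A \<and> C \<in> Sub A"
  "Imp B C \<in> Sub A \<Longrightarrow> B \<in> Sub A \<and> C \<in> Sub A"
  "Box B \<in> Sub A \<Longrightarrow> B \<in> Sub A"
  by (auto dest: Sub_mono simp: Sub_refl subset_iff)

section \<open>Forcing from a valuation, and soundness\<close>

primrec forces ::
    "'w set \<Rightarrow> ('p fm \<Rightarrow> ('w \<times> 'w) set) \<Rightarrow> ('w \<Rightarrow> 'p \<Rightarrow> bool) \<Rightarrow> 'p fm \<Rightarrow> 'w \<Rightarrow> bool" where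
  "forces W R V (Var p) = (\<lambda>x. V x p)"
| "forces W R V Bot = (\<lambda>x. False)"
| "forces W R V (Neg B) = (\<lambda>x. \<not> forces W R V B x)"
| "forces W R V (Conj B C) = (\<lambda>x. forces W R V B x \<and> forces W R V C x)"
| "forces W R V (Disj B C) = (\<lambda>x. forces W R V B x \<or> forces W R V C x)"
| "forces W R V (Imp B C) = (\<lambda>x. forces W R V B x \<longrightarrow> forces W R V C x)"
| "forces W R V (Box B) = (\<lambda>x. \<forall>y\<in>W. (x, y) \<in> R B \<longrightarrow> forces W R V B y)"

text \<open>Validity quantifies over satisfaction relations, so applying it to a chosen valuation
  requires a concrete one; \<open>forces\<close> builds it by recursion.\<close>

lemma N_model_forces: "N_frame W R \<Longrightarrow> N_model W R (\<lambda>x B. forces W R V B x)"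
  by (simp add: N_model_def)

lemma valid_in_forces: "N_frame W R \<Longrightarrow> valid_in W R A \<Longrightarrow> x \<in> W \<Longrightarrow> forces W R V A x"
  using N_model_forces unfolding valid_in_def by fast

lemma N_model_sat:
  assumes "N_model W R sat" "x \<in> W"
  shows "\<not> sat x Bot" "sat x (Neg B) \<longleftrightarrow> \<not> sat x B"
    "sat x (Conj B C) \<longleftrightarrow> sat x B \<and> sat x C" "sat x (Disj B C) \<longleftrightarrow> sat x B \<or> sat x C"
    "sat x (Imp B C) \<longleftrightarrow> (sat x B \<longrightarrow> sat x C)"
    "sat x (Box B) \<longleftrightarrow> (\<forall>y\<in>W. (x, y) \<in> R B \<longrightarrow> sat y B)"
  using assms by (simp_all add: N_model_def)

text \<open>With variables and boxed formulas read off \<open>sat x\<close> as atoms, both sides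
  obey the same propositional clauses; hence tautologies hold at every world.\<close>

lemma prop_eval_sat:
  assumes "N_model W R sat" "x \<in> W"
  shows "prop_eval (sat x) B = sat x B"
  by (induction B) (simp_all add: N_model_sat[OF assms])

lemma N_plus_sound:
  assumes "N_plus Ax A" "N_model W R sat" "\<And>x B. x \<in> W \<Longrightarrow> B \<in> Ax \<Longrightarrow> sat x B" "x \<in> W"
  shows "sat x A"
  using assms(1,4)
proof (induction arbitrary: x)
  case (Taut A)
  then show ?case
    using prop_eval_sat[OF assms(2)] by (metis tautology_def)
next
  case (Axiom A)
  then show ?case using assms(3) by blast
next
  case (MP A B)
  then show ?case by (simp add: N_model_sat[OF assms(2)])
next
  \<comment> \<open>The induction hypothesis covers every world of \<open>W\<close>, hence all
    successors of \<open>x\<close>.\<close>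
  case (Nec A)
  then show ?case by (simp add: N_model_sat[OF assms(2)])
qed

lemma N4_sound:
  assumes "N4 A" "transitive_frame W R"
  shows "valid_in W R A"
  unfolding valid_in_def
proof (intro allI impI ballI)
  fix sat x
  assume model: "N_model W R sat" and "x \<in> W"
  have "sat y (Imp (Box B) (Box (Box B)))" if "y \<in> W" for y B
  proof -
    have "(y, z') \<in> R B" if "z \<in> W" "z' \<in> W" "(y, z) \<in> R (Box B)" "(z, z') \<in> R B" for z z'
      using assms(2) \<open>y \<in> W\<close> that unfolding transitive_frame_def fm_transitive_def by metis
    then show ?thesis
      using that by (simp add: N_model_sat[OF model])
  qed
  then show "sat x A"
    using N_plus_sound[OF assms(1)[unfolded N4_def] model] \<open>x \<in> W\<close> by blast
qed

section \<open>From finite transitive to finite Sub(A)-transitive frames\<close>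

lemma valid_finite_Sub_transitiveI:
  fixes A :: "'p fm"
  assumes "valid_finite_transitive TYPE('w) A"
  shows "valid_finite_Sub_transitive TYPE('w) A"
  unfolding valid_finite_Sub_transitive_def valid_in_def
proof (intro allI impI ballI)
  fix W :: "'w set" and R sat x
  assume frame: "N_frame W R \<and> finite W \<and> set_transitive (Sub A) W R"
    and model: "N_model W R sat" and x: "x \<in> W"
  define R' where "R' B = (if Box B \<in> Sub A then R B else {})" for B
  define V where "V = (\<lambda>y p. sat y (Var p))"
  have frame': "N_frame W R'"
    using frame by (auto simp: N_frame_def R'_def)
  \<comment> \<open>If \<open>Box (Box B)\<close> is in \<open>Sub A\<close>, transitivity is
    inherited from \<open>R\<close>; otherwise \<open>R' (Box B)\<close> is empty and the condition
    is vacuous.\<close>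
  have "fm_transitive B W R'" for B
    using frame unfolding set_transitive_def fm_transitive_def R'_def by auto
  with frame frame' assms have "valid_in W R' A"
    unfolding valid_finite_transitive_def transitive_frame_def by blast
  then have "forces W R' V A x"
    by (rule valid_in_forces[OF frame' _ x])
  moreover have "B \<in> Sub A \<Longrightarrow> y \<in> W \<Longrightarrow> forces W R' V B y = sat y B" for B y
    by (induction B arbitrary: y)
      (auto simp: N_model_sat[OF model] R'_def V_def dest: Sub_closed)
  ultimately show "sat x A"
    using Sub_refl x by blast
qed

section \<open>Canonical worlds\<close>

lemma N_plus_finite_Conj:
  assumes "finite F" "\<And>D. D \<in> F \<Longrightarrow> N_plus Ax D"
  shows "\<exists>C. N_plus Ax C \<and> (\<forall>v. prop_eval v C \<longleftrightarrow> (\<forall>D\<in>F. prop_eval v D))"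
  using assms
proof (induction F rule: finite_induct)
  case empty
  have "N_plus Ax (Neg Bot)"
    by (rule N_plus.Taut) (simp add: tautology_def)
  then show ?case
    by (intro exI[of _ "Neg Bot"]) simp
next
  case (insert D F)
  then obtain C where C: "N_plus Ax C" "\<forall>v. prop_eval v C \<longleftrightarrow> (\<forall>D\<in>F. prop_eval v D)"
    by auto
  have "N_plus Ax (Imp D (Imp C (Conj D C)))"
    by (rule N_plus.Taut) (simp add: tautology_def)
  then have "N_plus Ax (Conj D C)"
    using insert.prems C(1) by (meson N_plus.MP insertI1)
  with C(2) show ?case
    by (intro exI[of _ "Conj D C"]) simp
qed

text \<open>These play the role of maximal consistent subsets of \<open>S\<close>. The valuation may
  depend on the theorem \<open>C\<close>, so no single valuation has to satisfy all theorems at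
  once.\<close>

definition worlds :: "'p fm set \<Rightarrow> 'p fm set \<Rightarrow> 'p fm set set" where
  "worlds Ax S =
    {X. X \<subseteq> S \<and> (\<forall>C. N_plus Ax C \<longrightarrow> (\<exists>v. prop_eval v C \<and> {D \<in> S. prop_eval v D} = X))}"

lemma finite_worlds: "finite S \<Longrightarrow> finite (worlds Ax S)"
  by (rule finite_subset[of _ "Pow S"]) (auto simp: worlds_def)

lemma worldsE:
  assumes "X \<in> worlds Ax S" "N_plus Ax C"
  obtains v where "prop_eval v C" "X = {D \<in> S. prop_eval v D}"
  using assms unfolding worlds_def by blast

text \<open>Otherwise each of the finitely many subsets of \<open>S\<close> omitting
  \<open>B\<close> has a theorem that fails under all valuations with that trace. The conjunction of
  these theorems tautologically implies \<open>B\<close>, making \<open>B\<close> provable.\<close>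

lemma ex_world_notin:
  assumes "finite S" "B \<in> S" "\<not> N_plus Ax B"
  shows "\<exists>X\<in>worlds Ax S. B \<notin> X"
proof (rule ccontr)
  assume none: "\<not> (\<exists>X\<in>worlds Ax S. B \<notin> X)"
  let ?P = "{X. X \<subseteq> S \<and> B \<notin> X}"
  have "\<forall>X\<in>?P. \<exists>C. N_plus Ax C \<and> (\<forall>v. {D \<in> S. prop_eval v D} = X \<longrightarrow> \<not> prop_eval v C)"
  proof
    fix X assume "X \<in> ?P"
    with none have "X \<notin> worlds Ax S" "X \<subseteq> S" by auto
    then show "\<exists>C. N_plus Ax C \<and> (\<forall>v. {D \<in> S. prop_eval v D} = X \<longrightarrow> \<not> prop_eval v C)"
      by (auto simp: worlds_def)
  qed
  from bchoice[OF this] obtain c where c: "\<forall>X\<in>?P. N_plus Ax (c X) \<and>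
      (\<forall>v. {D \<in> S. prop_eval v D} = X \<longrightarrow> \<not> prop_eval v (c X))"
    by (rule exE)
  have "finite (c ` ?P)"
    using assms(1) by simp
  then obtain C where C: "N_plus Ax C"
    "\<And>v. prop_eval v C \<longleftrightarrow> (\<forall>D\<in>c ` ?P. prop_eval v D)"
    using N_plus_finite_Conj[of "c ` ?P" Ax] c by blast
  have "prop_eval v B" if "prop_eval v C" for v
  proof (rule ccontr)
    assume "\<not> prop_eval v B"
    then have "{D \<in> S. prop_eval v D} \<in> ?P" by simp
    with that C(2)[of v] c show False by blast
  qed
  then have "N_plus Ax (Imp C B)"
    by (intro N_plus.Taut) (simp add: tautology_def)
  from N_plus.MP[OF this C(1)] assms(3) show False
    by contradiction
qed

section \<open>Completeness\<close>

lemma N4_complete: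
  fixes A :: "'p fm"
  assumes inf: "infinite (UNIV :: 'w set)"
    and valid: "valid_finite_Sub_transitive TYPE('w) A"
  shows "N4 A"
proof (rule ccontr)
  assume unprovable: "\<not> N4 A"
  define Ax where "Ax = {Imp (Box B) (Box (Box B)) | B :: 'p fm. True}"
  have N4: "N4 = N_plus Ax"
    by (simp add: N4_def Ax_def)
  define \<W> where "\<W> = worlds Ax (Sub A)"
  have "finite \<W>"
    by (simp add: \<W>_def finite_worlds finite_Sub)
  \<comment> \<open>The canonical worlds are sets of formulas; as \<open>'w\<close> is infinite, it
    contains a copy \<open>W\<close> of them, decoded by \<open>g\<close>.\<close>
  then obtain W :: "'w set" and g where W: "finite W" and g: "bij_betw g W \<W>"
    using infinite_arbitrarily_large[OF inf, of "card \<W>"] finite_same_card_bij by metis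
  \<comment> \<open>If \<open>Box B\<close> is absent from \<open>g x\<close>, then \<open>x\<close>
    sees all of \<open>W\<close> along \<open>R B\<close>, so any world omitting \<open>B\<close>
    refutes \<open>Box B\<close> at \<open>x\<close>.\<close>
  define R where "R B = {(x, y). x \<in> W \<and> y \<in> W \<and> (Box B \<in> g x \<longrightarrow> B \<in> g y)}" for B
  have R_iff: "(x, y) \<in> R B \<longleftrightarrow> x \<in> W \<and> y \<in> W \<and> (Box B \<in> g x \<longrightarrow> B \<in> g y)" for x y B
    by (simp add: R_def)
  define V where "V = (\<lambda>x p. Var p \<in> g x)"
  have world: "g x \<in> worlds Ax (Sub A)" if "x \<in> W" for x
    using g that unfolding \<W>_def bij_betw_def by blast
  have ex_notin: "\<exists>y\<in>W. B \<notin> g y" if "B \<in> Sub A" "\<not> N_plus Ax B" for B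
    using ex_world_notin[OF finite_Sub that] g unfolding \<W>_def bij_betw_def by blast
  obtain a where a: "a \<in> W" "A \<notin> g a"
    using ex_notin Sub_refl unprovable N4 by metis
  have frame: "N_frame W R"
    using a by (auto simp: N_frame_def R_def)
  have four: "Box (Box B) \<in> g x" if "x \<in> W" "Box (Box B) \<in> Sub A" "Box B \<in> g x" for x B
  proof -
    have "N_plus Ax (Imp (Box B) (Box (Box B)))"
      by (rule N_plus.Axiom) (auto simp: Ax_def)
    with world[OF that(1)] obtain v
      where "prop_eval v (Imp (Box B) (Box (Box B)))" "g x = {D \<in> Sub A. prop_eval v D}"
      by (rule worldsE)
    with that(2,3) show ?thesis by simp
  qed
  \<comment> \<open>Any theorem yields such a valuation; the empty conjunction supplies one.\<close>
  have trace: "\<exists>v. g x = {D \<in> Sub A. prop_eval v D}" if "x \<in> W" for x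
    using worldsE[OF world[OF that]] N_plus_finite_Conj[of "{}" Ax] by (metis empty_iff finite.emptyI)
  \<comment> \<open>From \<open>Box B\<close> in \<open>g x\<close>, \<open>four\<close> gives
    \<open>Box (Box B)\<close> in \<open>g x\<close>; the first step then puts \<open>Box B\<close>
    into \<open>g y\<close> and the second puts \<open>B\<close> into \<open>g z\<close>.\<close>
  have "set_transitive (Sub A) W R"
    using four unfolding set_transitive_def fm_transitive_def R_iff by blast
  then have "forces W R V A a"
    using valid frame W valid_in_forces[OF frame _ a(1)]
    by (simp add: valid_finite_Sub_transitive_def)
  moreover have "forces W R V B x \<longleftrightarrow> B \<in> g x" if "B \<in> Sub A" "x \<in> W" for B x
    using that
  proof (induction B arbitrary: x)
    case (Box B)
    have IH: "forces W R V B y \<longleftrightarrow> B \<in> g y" if "y \<in> W" for y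
      using Box.IH Box.prems(1) Sub_closed(5) that by blast
    show ?case
    proof (cases "Box B \<in> g x")
      case True
      then show ?thesis using IH by (auto simp: R_iff)
    next
      case False
      have "\<not> N_plus Ax B"
      proof
        assume "N_plus Ax B"
        then have "N_plus Ax (Box B)"
          by (rule N_plus.Nec)
        with world[OF Box.prems(2)] obtain v
          where "prop_eval v (Box B)" "g x = {D \<in> Sub A. prop_eval v D}"
          by (rule worldsE)
        with False Box.prems(1) show False by simp
      qed
      then obtain y where "y \<in> W" "B \<notin> g y"
        using ex_notin Box.prems(1) Sub_closed(5) by blast
      with False IH Box.prems(2) show ?thesis
        by (auto simp: R_iff)
    qed
  next
    case (Var p)
    then show ?case by (simp add: V_def)
  next
    case Bot
    with trace show ?case by fastforce
  next
    case (Neg B)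
    with trace[of x] Sub_closed(1)[OF Neg.prems(1)] show ?case by auto
  next
    case (Conj B C)
    with trace[of x] Sub_closed(2)[OF Conj.prems(1)] show ?case by auto
  next
    case (Disj B C)
    with trace[of x] Sub_closed(3)[OF Disj.prems(1)] show ?case by auto
  next
    case (Imp B C)
    with trace[of x] Sub_closed(4)[OF Imp.prems(1)] show ?case by auto
  qed
  ultimately show False
    using a Sub_refl by blast
qed

theorem theorem3p13:
  fixes A :: "'p fm"
  assumes "infinite (UNIV :: 'w set)"
  shows "(N4 A \<longleftrightarrow> valid_transitive TYPE('w) A) \<and>
    (valid_transitive TYPE('w) A \<longleftrightarrow> valid_finite_transitive TYPE('w) A) \<and>
    (valid_finite_transitive TYPE('w) A \<longleftrightarrow> valid_finite_Sub_transitive TYPE('w) A)"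
proof -
  have "N4 A \<Longrightarrow> valid_transitive TYPE('w) A"
    unfolding valid_transitive_def using N4_sound by blast
  moreover have "valid_transitive TYPE('w) A \<Longrightarrow> valid_finite_transitive TYPE('w) A"
    unfolding valid_transitive_def valid_finite_transitive_def by blast
  ultimately show ?thesis
    using valid_finite_Sub_transitiveI N4_complete[OF assms] by blast
qed

end
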